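(* There exist matroids $M_1=(E,\mathcal{B}_1)$ and $M_2=(E,\mathcal{B}_2)$ on a common ground set $E$ such that the pair $(M_1,M_2)$ satisfies (RCB), while the pair $(2M_1,2M_2)$ does not satisfy (RCB).
   Context: $M=(E,\mathcal{B})$ denotes a matroid on finite ground set $E$ with family of bases $\mathcal{B}$. A common basis of two matroids on the same ground set is a set that is a basis of both. A pair of matroids $(M_1,M_2)$ on a common ground set satisfies (RCB) (Reconfigurability of Common Bases) if for any pair of common bases $B$ and $B'$ of $M_1$ and $M_2$ there exists a sequence $B_0,B_1,\dots,B_\ell$ of common bases of $M_1$ and $M_2$ such that $B_0=B$, $B_\ell=B'$, and $|B_{i-1}\setminus B_i|=|B_i\setminus B_{i-1}|=1$ for each $i\in\{1,\dots,\ell\}$. For a matroid $M$ (having two disjoint bases), $2M$ is the matroid on the same ground set whose bases are the unions of two disjoint bases of $M$. *)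

theory Defs
  imports Main
begin

locale matroid =
  fixes E :: "'a set" and \<B> :: "'a set set"
  assumes finite_ground: "finite E"
    and bases_subset: "B \<in> \<B> \<Longrightarrow> B \<subseteq> E"
    and bases_nonempty: "\<B> \<noteq> {}"
    and basis_exchange: "\<lbrakk>X \<in> \<B>; Y \<in> \<B>; x \<in> X - Y\<rbrakk> \<Longrightarrow> \<exists>y\<in>Y - X. insert y (X - {x}) \<in> \<B>"

definition common_bases :: "'a set set \<Rightarrow> 'a set set \<Rightarrow> 'a set set" where
  "common_bases \<B>1 \<B>2 = \<B>1 \<inter> \<B>2"

text \<open>Reconfigurability of common bases. The arguments are the families of bases of two matroids
  on the same ground set; the ground set itself plays no role in the condition.\<close>

definition RCB :: "'a set set \<Rightarrow> 'a set set \<Rightarrow> bool" where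
  "RCB \<B>1 \<B>2 \<longleftrightarrow>
    (\<forall>B \<in> common_bases \<B>1 \<B>2. \<forall>B' \<in> common_bases \<B>1 \<B>2.
      \<exists>(l::nat) (S :: nat \<Rightarrow> 'a set).
        (\<forall>i\<in>{0..l}. S i \<in> common_bases \<B>1 \<B>2) \<and> S 0 = B \<and> S l = B' \<and>
        (\<forall>i\<in>{1..l}. card (S (i - 1) - S i) = 1 \<and> card (S i - S (i - 1)) = 1))"

definition has_two_disjoint_bases :: "'a set set \<Rightarrow> bool" where
  "has_two_disjoint_bases \<B> \<longleftrightarrow> (\<exists>X\<in>\<B>. \<exists>Y\<in>\<B>. X \<inter> Y = {})"

text \<open>The bases of \<open>2M\<close>, for a matroid \<open>M\<close> with family of bases \<open>\<B>\<close>. This is a family of bases of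
  a matroid only if \<open>M\<close> has two disjoint bases; otherwise it is empty.\<close>

definition double_bases :: "'a set set \<Rightarrow> 'a set set" where
  "double_bases \<B> = {X \<union> Y | X Y. X \<in> \<B> \<and> Y \<in> \<B> \<and> X \<inter> Y = {}}"

end

theory Submission
  imports Defs
begin

text \<open>
  Take the bipartite multigraph consisting of a 4-cycle, two opposite edges of which are doubled,
  and two isolated edges. Let \<open>M\<^sub>1\<close> and \<open>M\<^sub>2\<close> be the partition matroids given by the endpoints on
  either side, truncated to rank 3, so that common bases are the matchings of size 3. There is a
  matching of size 4, and the matchings of size 3 can be reconfigured through those that contain
  both isolated edges. A common basis of \<open>2M\<^sub>1\<close> and \<open>2M\<^sub>2\<close> has six edges and maximum degree two,
  hence contains both isolated edges and is 2-regular on the 4-cycle. The two doubled edges and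
  the simple 4-cycle are two such bases, but no single exchange leads away from the former.
\<close>

definition exchange_rel :: "'a set set \<Rightarrow> ('a set \<times> 'a set) set" where
  "exchange_rel \<C> = {(X, Y). X \<in> \<C> \<and> Y \<in> \<C> \<and> card (X - Y) = 1 \<and> card (Y - X) = 1}"

lemma sym_exchange_rel: "sym (exchange_rel \<C>)"
  by (auto simp: exchange_rel_def sym_def)

lemma exchange_relI:
  assumes "X \<in> \<C>" "insert y (X - {x}) \<in> \<C>" "x \<in> X" "y \<notin> X"
  shows "(X, insert y (X - {x})) \<in> exchange_rel \<C>"
proof -
  have "X - insert y (X - {x}) = {x}" "insert y (X - {x}) - X = {y}"
    using assms by auto
  then show ?thesis using assms by (simp add: exchange_rel_def)
qed

lemma exchange_relE:
  assumes "(X, Y) \<in> exchange_rel \<C>"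
  obtains x y where "x \<in> X" "y \<notin> X" "Y = insert y (X - {x})"
proof -
  obtain x y where "X - Y = {x}" "Y - X = {y}"
    using assms by (auto simp: exchange_rel_def card_1_singleton_iff)
  then show ?thesis using that[of x y] by blast
qed

text \<open>Indexed sequences become a reflexive transitive closure, so that paths can be joined,
  reversed and split at their first step.\<close>

lemma RCB_iff_reachable:
  "RCB \<B>1 \<B>2 \<longleftrightarrow>
    (\<forall>X \<in> \<B>1 \<inter> \<B>2. \<forall>Y \<in> \<B>1 \<inter> \<B>2. (X, Y) \<in> (exchange_rel (\<B>1 \<inter> \<B>2))\<^sup>*)"
proof -
  define \<C> where "\<C> = \<B>1 \<inter> \<B>2"
  have "(\<exists>(l::nat) S. (\<forall>i\<in>{0..l}. S i \<in> \<C>) \<and> S 0 = X \<and> S l = Y \<and>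
          (\<forall>i\<in>{1..l}. card (S (i - 1) - S i) = 1 \<and> card (S i - S (i - 1)) = 1))
        \<longleftrightarrow> (X, Y) \<in> (exchange_rel \<C>)\<^sup>*" if "X \<in> \<C>" for X Y
  proof -
    have "((\<forall>i\<in>{0..l}. S i \<in> \<C>) \<and> S 0 = X \<and> S l = Y \<and>
            (\<forall>i\<in>{1..l}. card (S (i - 1) - S i) = 1 \<and> card (S i - S (i - 1)) = 1))
          \<longleftrightarrow> S 0 = X \<and> S l = Y \<and> (\<forall>i<l. (S i, S (Suc i)) \<in> exchange_rel \<C>)"
      (is "?L \<longleftrightarrow> ?R") for l and S :: "nat \<Rightarrow> 'a set"
    proof
      assume L: ?L
      then have "card (S i - S (Suc i)) = 1 \<and> card (S (Suc i) - S i) = 1" if "i < l" for i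
        using that by (auto dest!: bspec[where x = "Suc i"])
      then show ?R using L by (auto simp: exchange_rel_def)
    next
      assume R: ?R
      \<comment> \<open>A positive index is the target of a step of the relation; index 0 is not,
        and for \<open>l = 0\<close> there are no steps at all, so membership of the start
        \<open>X\<close> is used there.\<close>
      have "S i \<in> \<C>" if "i \<le> l" for i
        using R that \<open>X \<in> \<C>\<close> by (cases i) (auto simp: exchange_rel_def Suc_le_eq)
      moreover have "card (S (i - 1) - S i) = 1 \<and> card (S i - S (i - 1)) = 1"
        if "i \<in> {1..l}" for i
        using R that by (cases i) (auto simp: exchange_rel_def Suc_le_eq)
      ultimately show ?L using R by auto
    qed
    then show ?thesis
      by (simp only: rtrancl_is_UN_relpow UN_iff bex_UNIV relpow_fun_conv)
  qed
  then show ?thesis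
    unfolding RCB_def common_bases_def \<C>_def by (intro ball_cong refl)
qed

text \<open>If nonempty, these are the bases of the partition matroid whose classes are the fibres
  of \<open>f\<close>, each of capacity one, truncated to rank \<open>r\<close>.\<close>

definition partition_bases :: "'a set \<Rightarrow> ('a \<Rightarrow> 'b) \<Rightarrow> nat \<Rightarrow> 'a set set" where
  "partition_bases E f r = {B. B \<subseteq> E \<and> card B = r \<and> inj_on f B}"

lemma matroid_partition_bases:
  assumes "finite E" "partition_bases E f r \<noteq> {}"
  shows "matroid E (partition_bases E f r)"
proof
  fix X Y x
  assume X: "X \<in> partition_bases E f r" and Y: "Y \<in> partition_bases E f r" and x: "x \<in> X - Y"
  have fin: "finite X" "finite Y"
    using X Y assms(1) by (auto simp: partition_bases_def intro: finite_subset)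
  \<comment> \<open>By counting, \<open>Y\<close> meets more fibres than \<open>X - {x}\<close>, so
    some \<open>y\<close> in \<open>Y\<close> has a new label; it cannot lie in
    \<open>X - {x}\<close>, and it is not \<open>x\<close> because \<open>x\<close> is outside
    \<open>Y\<close>.\<close>
  have "card (f ` (X - {x})) \<le> card (X - {x})"
    using fin by (simp add: card_image_le)
  also have "\<dots> < card X"
    using x fin by (intro psubset_card_mono) auto
  also have "\<dots> = card (f ` Y)"
    using X Y by (simp add: partition_bases_def card_image)
  finally have "\<not> f ` Y \<subseteq> f ` (X - {x})"
    using fin by (meson card_mono finite_Diff finite_imageI not_le)
  then obtain y where y: "y \<in> Y" "f y \<notin> f ` (X - {x})" by blast
  then have yX: "y \<in> Y - X" using x by blast
  moreover have "inj_on f (insert y (X - {x}))"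
    using X y by (auto simp: partition_bases_def intro: inj_on_diff)
  moreover have "card (insert y (X - {x})) = card X"
    using yX x fin card_Suc_Diff1[of X x] by auto
  ultimately show "\<exists>y\<in>Y - X. insert y (X - {x}) \<in> partition_bases E f r"
    using X Y by (auto simp: partition_bases_def)
qed (use assms in \<open>auto simp: partition_bases_def\<close>)

lemma double_partition_bases_subset:
  "Y \<in> double_bases (partition_bases E f r) \<Longrightarrow> Y \<subseteq> E"
  by (auto simp: double_bases_def partition_bases_def)

text \<open>Pigeonhole: two of three elements of a union of two bases lie in the same basis, on
  which \<open>f\<close> is injective.\<close>

lemma double_partition_bases_no_three:
  assumes "Y \<in> double_bases (partition_bases E f r)"
    and "f p = f q" "f q = f s" "distinct [p, q, s]"
  shows "\<not> {p, q, s} \<subseteq> Y"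
  using assms by (auto simp: double_bases_def partition_bases_def) (metis inj_onD)+

lemma double_basesI:
  "\<lbrakk>X \<in> \<B>; Y \<in> \<B>; X \<inter> Y = {}; Z = X \<union> Y\<rbrakk> \<Longrightarrow> Z \<in> double_bases \<B>"
  by (auto simp: double_bases_def)

text \<open>The edges \<open>0, \<dots>, 5\<close> form the 4-cycle, where \<open>0, 1\<close> and \<open>4, 5\<close> are the parallel pairs; the
  edges \<open>6\<close> and \<open>7\<close> are isolated.\<close>

definition left_end :: "nat \<Rightarrow> nat" where
  "left_end i = (if i \<in> {0, 1, 2} then 0 else if i \<in> {3, 4, 5} then 1 else i)"

definition right_end :: "nat \<Rightarrow> nat" where
  "right_end i = (if i \<in> {0, 1, 3} then 0 else if i \<in> {2, 4, 5} then 1 else i)"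

abbreviation "left_bases \<equiv> partition_bases {..<8} left_end 3"

abbreviation "right_bases \<equiv> partition_bases {..<8} right_end 3"

lemmas ends_simps = partition_bases_def left_end_def right_end_def inj_on_def

text \<open>The set \<open>{6, 7, 0}\<close> serves as a hub: every common basis reaches it in at
  most two exchanges.\<close>

lemma RCB_left_right: "RCB left_bases right_bases"
proof -
  define \<C> where "\<C> = left_bases \<inter> right_bases"
  have hub: "{6, 7, p} \<in> \<C>" if "p < 6" for p
    using that by (auto simp: \<C>_def ends_simps)
  have from_both: "(B, {6, 7, 0}) \<in> (exchange_rel \<C>)\<^sup>*" if B: "B \<in> \<C>" "{6, 7} \<subseteq> B" for B
  proof (cases "0 \<in> B")
    case True
    have "card B = 3" using B by (simp add: \<C>_def partition_bases_def)
    then have "{6, 7, 0} = B"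
      using B True by (intro card_subset_eq) (auto intro: card_ge_0_finite)
    then show ?thesis by simp
  next
    case False
    have "card B = 3" "B \<subseteq> {..<8}" using B by (auto simp: \<C>_def partition_bases_def)
    then have "card (B - {6, 7}) = 1" using B by (simp add: card_Diff_subset)
    then obtain p where p: "B - {6, 7} = {p}" by (auto simp: card_1_singleton_iff)
    then have "insert 0 (B - {p}) = {6, 7, 0}" using B by auto
    then show ?thesis
      using exchange_relI[of B \<C> 0 p] B hub[of 0] p False by auto
  qed
  \<comment> \<open>The missing isolated edge \<open>w\<close> replaces the cycle edge
    \<open>q\<close>; the result has the form \<open>{6, 7, p}\<close>, which is always a
    matching.\<close>
  have from_one: "(B, {6, 7, 0}) \<in> (exchange_rel \<C>)\<^sup>*"
    if B: "B \<in> \<C>" "w \<notin> B" "w' \<in> B" and w: "(w, w') \<in> {(6, 7), (7, 6)}" for B w w'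
  proof -
    have "card B = 3" and sub: "B \<subseteq> {..<8}"
      using B by (auto simp: \<C>_def partition_bases_def)
    then have "card (B - {w'}) = 2" using B by (simp add: card_Diff_singleton)
    then obtain p q where pq: "B - {w'} = {p, q}" "p \<noteq> q" by (auto simp: card_2_iff)
    have "p < 6"
    proof -
      have "p < 8" "p \<noteq> w" "p \<noteq> w'" using pq B sub by auto
      moreover have "6 \<in> {w, w'}" "7 \<in> {w, w'}" using w by auto
      ultimately show ?thesis by (cases "p = 6"; cases "p = 7") auto
    qed
    have "insert w (B - {q}) = {w, w'} \<union> {p}" using pq B by auto
    then have eq: "insert w (B - {q}) = {6, 7, p}" using w by auto
    have "(B, {6, 7, p}) \<in> exchange_rel \<C>"
      using exchange_relI[of B \<C> w q] B pq hub[OF \<open>p < 6\<close>] eq by auto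
    then show ?thesis
      using from_both[of "{6, 7, p}"] hub[OF \<open>p < 6\<close>]
      by (auto intro: converse_rtrancl_into_rtrancl)
  qed
  have to_hub: "(B, {6, 7, 0}) \<in> (exchange_rel \<C>)\<^sup>*" if B: "B \<in> \<C>" for B
  proof -
    have "6 \<in> B \<or> 7 \<in> B"
    proof (rule ccontr)
      assume none: "\<not> (6 \<in> B \<or> 7 \<in> B)"
      have "B \<subseteq> {..<8}" "card B = 3" "inj_on left_end B"
        using B by (auto simp: \<C>_def partition_bases_def)
      \<comment> \<open>The cycle has only two left vertices, so a matching within it has at most
        two edges.\<close>
      have "left_end i \<in> {0, 1}" if "i \<in> B" for i
      proof -
        have "i < 8" "i \<noteq> 6" "i \<noteq> 7" using none that \<open>B \<subseteq> {..<8}\<close> by auto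
        then have "i \<in> {0, 1, 2, 3, 4, 5}" by auto
        then show ?thesis by (auto simp: left_end_def)
      qed
      then have "left_end ` B \<subseteq> {0, 1}" by (rule image_subsetI)
      then have "card B \<le> card {0 :: nat, 1}"
        using card_inj_on_le[OF \<open>inj_on left_end B\<close>] by blast
      then show False using \<open>card B = 3\<close> by simp
    qed
    then show ?thesis
      using from_both[OF B] from_one[OF B, of 6 7] from_one[OF B, of 7 6] by auto
  qed
  have "(X, Y) \<in> (exchange_rel \<C>)\<^sup>*" if "X \<in> \<C>" "Y \<in> \<C>" for X Y
    using to_hub[OF that(1)] to_hub[OF that(2)] sym_rtrancl[OF sym_exchange_rel, of \<C>]
    by (meson rtrancl_trans symD)
  then show ?thesis by (simp add: RCB_iff_reachable \<C>_def)
qed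

lemma not_RCB_double_left_right:
  "\<not> RCB (double_bases left_bases) (double_bases right_bases)"
proof
  define \<C> where "\<C> = double_bases left_bases \<inter> double_bases right_bases"
  define X :: "nat set" where "X = {0, 1, 4, 5, 6, 7}"
  define X' :: "nat set" where "X' = {0, 2, 3, 4, 6, 7}"
  assume "RCB (double_bases left_bases) (double_bases right_bases)"
  moreover have "X \<in> double_bases left_bases"
    by (rule double_basesI[of "{0, 4, 6}" _ "{1, 5, 7}"]) (auto simp: X_def ends_simps)
  moreover have "X \<in> double_bases right_bases"
    by (rule double_basesI[of "{0, 4, 6}" _ "{1, 5, 7}"]) (auto simp: X_def ends_simps)
  moreover have "X' \<in> double_bases left_bases"
    \<comment> \<open>The partition of \<open>X'\<close> into two bases may differ between the two
      matroids, and here it does.\<close>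
    by (rule double_basesI[of "{0, 3, 6}" _ "{2, 4, 7}"]) (auto simp: X'_def ends_simps)
  moreover have "X' \<in> double_bases right_bases"
    by (rule double_basesI[of "{0, 2, 6}" _ "{3, 4, 7}"]) (auto simp: X'_def ends_simps)
  ultimately have "(X, X') \<in> (exchange_rel \<C>)\<^sup>*"
    by (simp add: RCB_iff_reachable \<C>_def)
  moreover have "1 \<in> X" "1 \<notin> X'" by (simp_all add: X_def X'_def)
  then have "X \<noteq> X'" by blast
  \<comment> \<open>Since \<open>X\<close> differs from \<open>X'\<close>, the path has a first
    step; it remains to show that \<open>X\<close> has no neighbour.\<close>
  ultimately obtain Y where XY: "(X, Y) \<in> exchange_rel \<C>"
    by (metis converse_rtranclE)
  then have left: "Y \<in> double_bases left_bases" and right: "Y \<in> double_bases right_bases"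
    by (auto simp: exchange_rel_def \<C>_def)
  obtain x y where xy: "x \<in> X" "y \<notin> X" "Y = insert y (X - {x})"
    using XY by (rule exchange_relE)
  have "y < 8" using double_partition_bases_subset[OF left] xy by auto
  then consider "y = 2" | "y = 3" using xy(2) by (fastforce simp: X_def)
  \<comment> \<open>Either new edge joins a vertex of one doubled pair to a vertex of the other and
    would give both degree three. The single removed edge would have to lie in both pairs, which are
    disjoint.\<close>
  then have "(x = 0 \<or> x = 1) \<and> (x = 4 \<or> x = 5)"
  proof cases
    case 1
    have "\<not> {0, 1, 2} \<subseteq> Y"
      by (rule double_partition_bases_no_three[OF left]) (simp_all add: left_end_def)
    moreover have "\<not> {2, 4, 5} \<subseteq> Y"
      by (rule double_partition_bases_no_three[OF right]) (simp_all add: right_end_def)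
    ultimately show ?thesis by (simp add: xy(3) 1 X_def) metis
  next
    case 2
    have "\<not> {3, 4, 5} \<subseteq> Y"
      by (rule double_partition_bases_no_three[OF left]) (simp_all add: left_end_def)
    moreover have "\<not> {0, 1, 3} \<subseteq> Y"
      by (rule double_partition_bases_no_three[OF right]) (simp_all add: right_end_def)
    ultimately show ?thesis by (simp add: xy(3) 2 X_def) metis
  qed
  then show False by auto
qed

theorem theorem1p4:
  "\<exists>(E :: nat set) \<B>1 \<B>2.
     matroid E \<B>1 \<and> matroid E \<B>2 \<and>
     has_two_disjoint_bases \<B>1 \<and> has_two_disjoint_bases \<B>2 \<and>
     RCB \<B>1 \<B>2 \<and> \<not> RCB (double_bases \<B>1) (double_bases \<B>2)"
proof (intro exI conjI)
  \<comment> \<open>These two disjoint perfect matchings of the doubled pairs and isolated edges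
    show both that the families are nonempty and that each matroid has two disjoint bases.\<close>
  have bases: "{0, 4, 6} \<in> left_bases" "{1, 5, 7} \<in> left_bases"
    "{0, 4, 6} \<in> right_bases" "{1, 5, 7} \<in> right_bases"
    by (auto simp: ends_simps)
  show "matroid {..<8} left_bases" "matroid {..<8} right_bases"
    using bases by (auto intro!: matroid_partition_bases)
  have "{0, 4, 6} \<inter> {1, 5, 7 :: nat} = {}" by simp
  then show "has_two_disjoint_bases left_bases" "has_two_disjoint_bases right_bases"
    unfolding has_two_disjoint_bases_def using bases by metis+
  show "RCB left_bases right_bases" by (rule RCB_left_right)
  show "\<not> RCB (double_bases left_bases) (double_bases right_bases)"
    by (rule not_RCB_double_left_right)
qed

end
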